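(* For every three integers $r,s,t$ with $2\le r\le s\le t$, there exists a graph $G$ such that $\delta(G)+1 = r$, $\gamma'_{\rm SMB}(G) = s$, and $\gamma_{\rm SMB}(G) = t$.
   Context: All graphs are finite and simple; $\delta(G)$ is the minimum degree of $G$ and $N_G[v]=N_G(v)\cup\{v\}$ is the closed neighborhood of $v$. The Maker-Breaker domination game on a graph $G$ is played by two players, Dominator and Staller, who alternately choose (play) a vertex of $G$ that has not been played before. Dominator wins if the set of vertices he has played is a dominating set of $G$; Staller wins if she has played all vertices of $N_G[v]$ for some vertex $v\in V(G)$ (exactly one of these eventually happens). In the D-game Dominator makes the first move, in the S-game Staller does. $\gamma_{\rm SMB}(G)$ (resp. $\gamma'_{\rm SMB}(G)$) is the smallest integer $k$ such that in the D-game (resp. S-game), under any strategy of Dominator, Staller can win having played at most $k$ vertices; if Staller has no winning strategy, the value is $\infty$. *)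

theory Defs
  imports "Graph_Theory.Pair_Digraph" "HOL-Library.Extended_Nat"
begin

text \<open>
  A finite simple graph is a \<^const>\<open>pair_graph\<close>: each undirected edge \<open>uv\<close> is represented by
  the two arcs \<open>(u, v)\<close> and \<open>(v, u)\<close>.
\<close>

definition nbhd :: "'a pair_pre_digraph \<Rightarrow> 'a \<Rightarrow> 'a set" where
  "nbhd G v = {u. (v, u) \<in> parcs G}"

definition closed_nbhd :: "'a pair_pre_digraph \<Rightarrow> 'a \<Rightarrow> 'a set" where
  "closed_nbhd G v = insert v (nbhd G v)"

text \<open>Only meaningful if \<open>G\<close> has at least one vertex.\<close>
definition min_degree :: "'a pair_pre_digraph \<Rightarrow> nat" where
  "min_degree G = Min ((\<lambda>v. card (nbhd G v)) ` pverts G)"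

datatype player = Dominator | Staller

fun opponent :: "player \<Rightarrow> player" where
  "opponent Dominator = Staller"
| "opponent Staller = Dominator"

definition to_move :: "player \<Rightarrow> nat \<Rightarrow> player" where
  "to_move first i = (if even i then first else opponent first)"

text \<open>
  A strategy maps the chronological list of all moves made so far (by both players) to the next
  vertex to be played; it is legal if it always picks an unplayed vertex as long as there is one.
\<close>
type_synonym 'a strategy = "'a list \<Rightarrow> 'a"

definition legal_strategy :: "'a pair_pre_digraph \<Rightarrow> 'a strategy \<Rightarrow> bool" where
  "legal_strategy G f \<longleftrightarrow> (\<forall>h. set h \<subset> pverts G \<longrightarrow> f h \<in> pverts G - set h)"

primrec moves_made :: "player \<Rightarrow> (player \<Rightarrow> 'a strategy) \<Rightarrow> nat \<Rightarrow> 'a list" where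
  "moves_made first f 0 = []"
| "moves_made first f (Suc n) =
     moves_made first f n @ [f (to_move first n) (moves_made first f n)]"

definition played_by :: "player \<Rightarrow> player \<Rightarrow> 'a list \<Rightarrow> 'a set" where
  "played_by first p h = {h ! i | i. i < length h \<and> to_move first i = p}"

definition staller_won :: "'a pair_pre_digraph \<Rightarrow> player \<Rightarrow> 'a list \<Rightarrow> bool" where
  "staller_won G first h \<longleftrightarrow> (\<exists>v\<in>pverts G. closed_nbhd G v \<subseteq> played_by first Staller h)"

text \<open>
  The bound \<open>n \<le> card (pverts G)\<close> restricts attention to the actual play, which ends once every
  vertex has been played. Play may formally go on after somebody has won; this is harmless, since a
  set of vertices played by Dominator is dominating iff it meets every closed neighbourhood, so
  that a win of one player rules out a later win of the other.
\<close>
definition staller_wins_within ::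
  "'a pair_pre_digraph \<Rightarrow> player \<Rightarrow> nat \<Rightarrow> (player \<Rightarrow> 'a strategy) \<Rightarrow> bool" where
  "staller_wins_within G first k f \<longleftrightarrow>
     (\<exists>n \<le> card (pverts G).
        staller_won G first (moves_made first f n) \<and>
        card (played_by first Staller (moves_made first f n)) \<le> k)"

definition staller_can_win_within :: "'a pair_pre_digraph \<Rightarrow> player \<Rightarrow> nat \<Rightarrow> bool" where
  "staller_can_win_within G first k \<longleftrightarrow>
     (\<exists>\<sigma>. legal_strategy G \<sigma> \<and>
       (\<forall>\<delta>. legal_strategy G \<delta> \<longrightarrow>
          staller_wins_within G first k (case_player \<delta> \<sigma>)))"

text \<open>The infimum of the empty set in \<^typ>\<open>enat\<close> is \<open>\<infinity>\<close>.\<close>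
definition SMB_number :: "player \<Rightarrow> 'a pair_pre_digraph \<Rightarrow> enat" where
  "SMB_number first G = Inf {enat k | k. staller_can_win_within G first k}"

abbreviation gamma_SMB :: "'a pair_pre_digraph \<Rightarrow> enat" where
  "gamma_SMB \<equiv> SMB_number Dominator"

abbreviation gamma_SMB' :: "'a pair_pre_digraph \<Rightarrow> enat" where
  "gamma_SMB' \<equiv> SMB_number Staller"

end

theory Submission
  imports Defs "HOL-Library.Sublist"
begin

text \<open>
  Let \<open>G\<close> be the comparability graph of a rooted forest. The closed neighbourhood of a leaf is its
  root-to-leaf path, and every other closed neighbourhood contains such a path, so Staller wins iff
  she occupies a root-to-leaf path. On a perfect binary tree with \<open>n\<close> levels Staller, moving first,
  wins in \<open>n\<close> moves by walking from the root into a subtree that Dominator has not touched. The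
  forest consists of a path with \<open>r\<close> vertices and two perfect binary trees with \<open>s\<close> and \<open>t\<close> levels.
  Dominator spoils the path by any move on it, which as \<open>2 \<le> r\<close> he can still make after Staller's
  first move, and in the D-game he first spoils the smaller tree by taking its root; every
  root-to-leaf path that remains has at least \<open>s\<close> (in the D-game: \<open>t\<close>) vertices.
\<close>

section \<open>Plays\<close>

lemma length_moves_made [simp]: "length (moves_made first f n) = n"
  by (induction n) auto

lemma take_moves_made: "m \<le> n \<Longrightarrow> take m (moves_made first f n) = moves_made first f m"
  by (induction n) (auto simp: le_Suc_eq)

lemma nth_moves_made:
  assumes "i < n"
  shows "moves_made first f n ! i = f (to_move first i) (moves_made first f i)"
proof -
  have "moves_made first f n ! i = take (Suc i) (moves_made first f n) ! i"
    by simp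
  also have "\<dots> = moves_made first f (Suc i) ! i"
    using assms by (simp only: take_moves_made Suc_le_eq)
  finally show ?thesis
    by (simp add: nth_append)
qed

lemma played_by_Nil [simp]: "played_by first p [] = {}"
  by (simp add: played_by_def)

lemma played_by_snoc:
  "played_by first p (h @ [x]) =
     played_by first p h \<union> (if to_move first (length h) = p then {x} else {})"
proof -
  let ?I = "{i. i < length h \<and> to_move first i = p}"
  have "played_by first p (h @ [x]) =
      (\<lambda>i. (h @ [x]) ! i) ` {i. i < Suc (length h) \<and> to_move first i = p}"
    by (auto simp: played_by_def)
  also have "{i. i < Suc (length h) \<and> to_move first i = p} =
      ?I \<union> (if to_move first (length h) = p then {length h} else {})"
    by (auto simp: less_Suc_eq)
  also have "(\<lambda>i. (h @ [x]) ! i) ` \<dots> =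
      (\<lambda>i. h ! i) ` ?I \<union> (if to_move first (length h) = p then {x} else {})"
    by (auto simp: image_Un nth_append)
  also have "(\<lambda>i. h ! i) ` ?I = played_by first p h"
    by (auto simp: played_by_def)
  finally show ?thesis .
qed

lemma finite_played_by [simp]: "finite (played_by first p h)"
  by (simp add: played_by_def)

text \<open>Legality guarantees a fresh vertex only while some vertex is unplayed. Inductively
  \<open>n\<close> moves occupy exactly \<open>n\<close> vertices, so below the bound there always
  is one.\<close>

lemma set_moves_made_bounded:
  assumes "finite (pverts G)" and "\<And>p. legal_strategy G (f p)" and "n \<le> card (pverts G)"
  shows "distinct (moves_made first f n) \<and> set (moves_made first f n) \<subseteq> pverts G"
  using assms(3)
proof (induction n)
  case (Suc n)
  let ?h = "moves_made first f n"
  have h: "distinct ?h" "set ?h \<subseteq> pverts G"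
    using Suc by auto
  then have "card (set ?h) = n"
    by (simp add: distinct_card)
  then have "set ?h \<subset> pverts G"
    using h Suc.prems by auto
  then have "f (to_move first n) ?h \<in> pverts G - set ?h"
    using assms(2) by (auto simp: legal_strategy_def)
  then show ?case
    using h by auto
qed simp

lemma SMB_number_eqI:
  assumes "staller_can_win_within G first k"
    and "\<And>l. staller_can_win_within G first l \<Longrightarrow> k \<le> l"
  shows "SMB_number first G = enat k"
  unfolding SMB_number_def
proof (rule antisym)
  show "Inf {enat k | k. staller_can_win_within G first k} \<le> enat k"
    using assms(1) by (intro Inf_lower) blast
  show "enat k \<le> Inf {enat k | k. staller_can_win_within G first k}"
    using assms(2) by (intro Inf_greatest) auto
qed

section \<open>Staller walks down a binary tree\<close>

text \<open>Words of length at most \<open>d\<close> are the nodes of the perfect binary tree of height \<open>d\<close>.\<close>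
definition tree_embedding :: "'a pair_pre_digraph \<Rightarrow> (bool list \<Rightarrow> 'a) \<Rightarrow> nat \<Rightarrow> bool" where
  "tree_embedding G a d \<longleftrightarrow>
     inj_on a {xs. length xs \<le> d} \<and> a ` {xs. length xs \<le> d} \<subseteq> pverts G \<and>
     (\<forall>xs. length xs = d \<longrightarrow> closed_nbhd G (a xs) \<subseteq> (\<lambda>j. a (take j xs)) ` {..d})"

text \<open>
  When it is Staller's turn, \<open>length h div 2\<close> is the number of her moves so far, whoever started.
\<close>
definition open_node ::
  "player \<Rightarrow> (bool list \<Rightarrow> 'a) \<Rightarrow> nat \<Rightarrow> 'a list \<Rightarrow> bool list \<Rightarrow> bool" where
  "open_node first a d h xs \<longleftrightarrow>
     length xs = length h div 2 \<and> length xs \<le> d \<and>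
     played_by first Staller h = (\<lambda>j. a (take j xs)) ` {..<length xs} \<and>
     (\<forall>ys. length (xs @ ys) \<le> d \<longrightarrow> a (xs @ ys) \<notin> set h)"

text \<open>Here \<open>e first\<close> counts the moves that precede Staller's first one, and
  \<open>tree\<close> says that every such opening leaves a suitable tree untouched. From then on
  Staller plays the root of a free subtree; a single reply spoils at most one of its two child
  subtrees. The path she completes has \<open>d + 1\<close> vertices, hence
  \<open>d < k\<close>.\<close>

lemma staller_can_win_within_trees:
  fixes G :: "'a pair_pre_digraph"
  defines "e \<equiv> \<lambda>first. if first = Staller then 0 else 1 :: nat"
  assumes fin: "finite (pverts G)" and ne: "pverts G \<noteq> {}"
    and tree: "\<And>h. length h = e first \<Longrightarrow> set h \<subseteq> pverts G \<Longrightarrow>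
      \<exists>a d. d < k \<and> tree_embedding G a d \<and> a ` {xs. length xs \<le> d} \<inter> set h = {}"
  shows "staller_can_win_within G first k"
proof -
  \<comment> \<open>A strategy sees only the history, so the tree is chosen as a function of the
    opening and recovered later from \<open>take (e first) h\<close>.\<close>
  obtain A D where AD: "\<And>h. length h = e first \<Longrightarrow> set h \<subseteq> pverts G \<Longrightarrow>
      D h < k \<and> tree_embedding G (A h) (D h) \<and> A h ` {xs. length xs \<le> D h} \<inter> set h = {}"
    using tree by metis
  define opn where "opn h = open_node first (A (take (e first) h)) (D (take (e first) h)) h" for h
  \<comment> \<open>The fallback to an arbitrary unplayed vertex makes \<sigma> legal also on
    histories that offer no open node.\<close>
  define \<sigma> where "\<sigma> h =
    (let x = A (take (e first) h) (SOME xs. opn h xs)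
     in if x \<in> pverts G - set h then x else SOME x. x \<in> pverts G - set h)" for h
  have legal: "legal_strategy G \<sigma>"
    unfolding legal_strategy_def \<sigma>_def Let_def
    by (metis (mono_tags, lifting) DiffI psubset_imp_ex_mem someI_ex)
  have "staller_wins_within G first k (case_player \<delta> \<sigma>)" if \<delta>: "legal_strategy G \<delta>" for \<delta>
  proof -
    let ?f = "case_player \<delta> \<sigma>"
    let ?M = "moves_made first ?f"
    have legal_f: "legal_strategy G (?f p)" for p
      using legal \<delta> by (cases p) auto
    have M: "distinct (?M n)" "set (?M n) \<subseteq> pverts G" if "n \<le> card (pverts G)" for n
      using set_moves_made_bounded[OF fin legal_f that] by auto
    \<comment> \<open>A vertex still unplayed shows that the board is not full, so one more move
      stays within the length of an actual play.\<close>
    have small: "n < card (pverts G)"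
      if "n \<le> card (pverts G)" "v \<in> pverts G" "v \<notin> set (?M n)" for n v
    proof -
      have "card (set (?M n)) < card (pverts G)"
        using M(2)[OF that(1)] that fin by (intro psubset_card_mono) auto
      then show ?thesis
        using M(1)[OF that(1)] by (simp add: distinct_card)
    qed
    define h0 where "h0 = ?M (e first)"
    define a d where "a = A h0" and "d = D h0"
    have e_card: "e first \<le> card (pverts G)"
      using fin ne by (auto simp: e_def Suc_le_eq card_gt_0_iff)
    have h0: "d < k" "tree_embedding G a d" "a ` {xs. length xs \<le> d} \<inter> set h0 = {}"
      using AD[of h0] M(2)[OF e_card] by (auto simp: h0_def a_def d_def)
    have inj: "a xs = a ys \<longleftrightarrow> xs = ys" if "length xs \<le> d" "length ys \<le> d" for xs ys
      using h0(2) that by (auto simp: tree_embedding_def inj_on_def)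
    have verts: "a xs \<in> pverts G" if "length xs \<le> d" for xs
      using h0(2) that by (auto simp: tree_embedding_def)
    have opn_M: "opn (?M n) = open_node first a d (?M n)" if "e first \<le> n" for n
      using that by (simp add: opn_def take_moves_made h0_def a_def d_def)
    have turn_S: "to_move first (2 * m + e first) = Staller" for m
      by (cases first) (auto simp: to_move_def e_def)
    have turn_D: "to_move first (Suc (2 * m + e first)) = Dominator" for m
      by (cases first) (auto simp: to_move_def e_def)
    have div: "(2 * m + e first) div 2 = m" for m
      by (auto simp: e_def)
    \<comment> \<open>Both child subtrees may be free, so the node picked by \<open>SOME\<close>
      need not be the given witness; any open node serves.\<close>
    have move_S: "\<exists>xs. open_node first a d (?M (2 * m + e first)) xs \<and>
        ?M (Suc (2 * m + e first)) = ?M (2 * m + e first) @ [a xs]"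
      if "\<exists>xs. open_node first a d (?M (2 * m + e first)) xs" for m
    proof -
      let ?h = "?M (2 * m + e first)"
      define xs where "xs = (SOME xs. opn ?h xs)"
      have *: "open_node first a d ?h xs"
        using that someI_ex[of "opn ?h"] by (simp add: opn_M xs_def)
      then have "a xs \<notin> set ?h" "length xs \<le> d"
        by (auto simp: open_node_def dest: spec[where x = "[]"])
      moreover have "A (take (e first) ?h) = a"
        by (simp add: take_moves_made a_def h0_def)
      ultimately have "\<sigma> ?h = a xs"
        using verts by (simp add: \<sigma>_def Let_def flip: xs_def)
      then show ?thesis
        using * by (auto simp: turn_S)
    qed
    \<comment> \<open>After \<open>m\<close> moves of Staller there is an open node at depth
      \<open>m\<close>. The length bound is carried along because freshness of moves is known only
      below it.\<close>
    have inv: "(\<exists>xs. open_node first a d (?M (2 * m + e first)) xs) \<and> 2 * m + e first \<le> card (pverts G)"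
      if "m \<le> d" for m
      using that
    proof (induction m)
      case 0
      have "played_by first Staller (?M (e first)) = {}"
        by (cases first) (auto simp: played_by_def e_def to_move_def)
      then have "open_node first a d (?M (e first)) []"
        using h0(3) by (auto simp: open_node_def e_def h0_def)
      then show ?case
        using e_card by auto
    next
      case (Suc m)
      let ?n = "2 * m + e first"
      have n: "?n \<le> card (pverts G)"
        using Suc by auto
      obtain xs where xs: "open_node first a d (?M ?n) xs" and M1: "?M (Suc ?n) = ?M ?n @ [a xs]"
        using move_S Suc by (meson Suc_leD)
      have len: "length xs = m"
        using xs by (simp add: open_node_def div)
      have free: "a (xs @ ys) \<notin> set (?M ?n)" if "m + length ys \<le> d" for ys
        using xs that len by (auto simp: open_node_def)
      have "?n < card (pverts G)"
        using small[OF n verts, of xs] free[of "[]"] len Suc.prems by auto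
      moreover have free1: "a (xs @ b # ys) \<notin> set (?M (Suc ?n))" if "m + Suc (length ys) \<le> d" for b ys
        unfolding M1 using free[of "b # ys"] inj[of "xs @ b # ys" xs] that len by auto
      ultimately have n1: "Suc ?n < card (pverts G)"
        using small[OF _ verts, of "Suc ?n" "xs @ [True]"] len Suc.prems by auto
      define y where "y = \<delta> (?M (Suc ?n))"
      have M2: "?M (Suc (Suc ?n)) = ?M (Suc ?n) @ [y]"
        by (simp only: moves_made.simps(2)[of _ _ "Suc ?n"] turn_D player.case y_def)
      \<comment> \<open>The child subtrees below \<open>xs\<close> are disjoint: if \<delta>'s reply
        \<open>y\<close> lay in both, injectivity of \<open>a\<close> would equate
        \<open>True\<close> and \<open>False\<close>.\<close>
      have "\<exists>b. \<forall>ys. m + Suc (length ys) \<le> d \<longrightarrow> a (xs @ b # ys) \<noteq> y"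
      proof (rule ccontr)
        assume "\<not> ?thesis"
        then obtain us vs where "m + Suc (length us) \<le> d" "a (xs @ True # us) = y"
          "m + Suc (length vs) \<le> d" "a (xs @ False # vs) = y"
          by meson
        then show False
          using inj[of "xs @ True # us" "xs @ False # vs"] len by auto
      qed
      then obtain b where b: "\<And>ys. m + Suc (length ys) \<le> d \<Longrightarrow> a (xs @ b # ys) \<noteq> y"
        by blast
      have "played_by first Staller (?M (Suc (Suc ?n))) = played_by first Staller (?M ?n) \<union> {a xs}"
        unfolding M2 M1 by (simp only: played_by_snoc length_append length_moves_made)
          (simp add: turn_S turn_D)
      also have "\<dots> = (\<lambda>j. a (take j (xs @ [b]))) ` {..<m} \<union> {a xs}"
        using xs len by (auto simp: open_node_def)
      also have "\<dots> = (\<lambda>j. a (take j (xs @ [b]))) ` {..<Suc m}"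
        using len by (auto simp: lessThan_Suc)
      finally have "open_node first a d (?M (Suc (Suc ?n))) (xs @ [b])"
        using len Suc.prems b free1 by (auto simp: open_node_def div M2 simp del: moves_made.simps)
      then show ?case
        using n1 by (auto simp del: moves_made.simps)
    qed
    \<comment> \<open>At \<open>m = d\<close> the open node is a leaf all of whose proper ancestors
      belong to Staller; playing it fills the leaf's closed neighbourhood.\<close>
    let ?n = "2 * d + e first"
    obtain xs where xs: "open_node first a d (?M ?n) xs" and M1: "?M (Suc ?n) = ?M ?n @ [a xs]"
      using move_S inv[of d] by blast
    have len: "length xs = d"
      using xs by (simp add: open_node_def div)
    have "a xs \<notin> set (?M ?n)"
      using xs by (auto simp: open_node_def dest: spec[where x = "[]"])
    then have "Suc ?n \<le> card (pverts G)"
      using small[of ?n "a xs"] verts[of xs] inv[of d] len by auto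
    moreover have path: "played_by first Staller (?M (Suc ?n)) = (\<lambda>j. a (take j xs)) ` {..d}"
      using xs len by (auto simp: M1 played_by_snoc turn_S open_node_def ivl_disj_un_singleton(2)[symmetric]
          simp del: moves_made.simps)
    moreover have "staller_won G first (?M (Suc ?n))"
      unfolding staller_won_def path using h0(2) len verts[of xs]
      by (intro bexI[of _ "a xs"]) (auto simp: tree_embedding_def)
    moreover have "card ((\<lambda>j. a (take j xs)) ` {..d}) \<le> k"
      using card_image_le[of "{..d}" "\<lambda>j. a (take j xs)"] h0(1) by simp
    ultimately show ?thesis
      unfolding staller_wins_within_def by metis
  qed
  then show ?thesis
    using legal unfolding staller_can_win_within_def by blast
qed

section \<open>Dominator spoils small neighbourhoods\<close>

text \<open>\<open>R\<close> collects vertices that Dominator wants at all costs, while from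
  \<open>K\<close> a single vertex will be enough for him. The last resort \<open>V\<close> is there
  for legality.\<close>

definition priority_strategy :: "'a set \<Rightarrow> 'a set \<Rightarrow> 'a set \<Rightarrow> 'a strategy" where
  "priority_strategy V R K h =
     (SOME x. x \<in> (if R - set h \<noteq> {} then R else if K - set h \<noteq> {} then K else V) - set h)"

lemma legal_priority_strategy:
  assumes "R \<subseteq> pverts G" "K \<subseteq> pverts G"
  shows "legal_strategy G (priority_strategy (pverts G) R K)"
  unfolding legal_strategy_def
proof (intro allI impI)
  fix h :: "'a list"
  assume h: "set h \<subset> pverts G"
  let ?X = "(if R - set h \<noteq> {} then R else if K - set h \<noteq> {} then K else pverts G) - set h"
  have "?X \<noteq> {}"
    using h by auto
  then have "priority_strategy (pverts G) R K h \<in> ?X"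
    unfolding priority_strategy_def by (rule some_in_eq[THEN iffD2])
  then show "priority_strategy (pverts G) R K h \<in> pverts G - set h"
    using assms by (auto split: if_splits)
qed

lemma priority_strategy_first: "R - set h \<noteq> {} \<Longrightarrow> priority_strategy V R K h \<in> R - set h"
  unfolding priority_strategy_def by (simp only: if_True not_False_eq_True some_in_eq)

lemma priority_strategy_second:
  assumes "R \<subseteq> set h" and "K - set h \<noteq> {}"
  shows "priority_strategy V R K h \<in> K - set h"
proof -
  have "R - set h = {}"
    using assms(1) by blast
  then have "priority_strategy V R K h = (SOME x. x \<in> K - set h)"
    using assms(2) by (simp only: priority_strategy_def simp_thms if_True if_False)
  then show ?thesis
    using assms(2) by (simp only: some_in_eq simp_thms)
qed

text \<open>Without repetitions a vertex determines the index at which it was played, and the parity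
  of the index determines the player.\<close>

lemma played_by_disjoint:
  assumes "distinct h"
  shows "played_by first Dominator h \<inter> played_by first Staller h = {}"
proof -
  have False if v: "v \<in> played_by first Dominator h" "v \<in> played_by first Staller h" for v
  proof -
    obtain i j where "i < length h" "to_move first i = Dominator" "h ! i = v"
      and "j < length h" "to_move first j = Staller" "h ! j = v"
      using v unfolding played_by_def by auto
    then have "i = j" "to_move first i \<noteq> to_move first j"
      using assms by (simp_all flip: nth_eq_iff_index_eq[of h])
    then show False
      by simp
  qed
  then show ?thesis
    by blast
qed

lemma in_played_byI: "i < length h \<Longrightarrow> to_move first i = p \<Longrightarrow> h ! i \<in> played_by first p h"
  unfolding played_by_def by blast

text \<open>Staller's strategy has to succeed against every \<delta>, so one good \<delta> yields
  the bound: if it never lets her fill a closed neighbourhood with fewer than \<open>k\<close>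
  vertices, the one she does fill costs her at least \<open>k\<close> moves.\<close>

lemma staller_bound:
  assumes \<delta>: "legal_strategy G \<delta>"
    and bound: "\<And>n \<sigma> v. legal_strategy G \<sigma> \<Longrightarrow> n \<le> card (pverts G) \<Longrightarrow> v \<in> pverts G \<Longrightarrow>
      card (closed_nbhd G v) < k \<Longrightarrow>
      closed_nbhd G v \<subseteq> played_by first Staller (moves_made first (case_player \<delta> \<sigma>) n) \<Longrightarrow> False"
    and win: "staller_can_win_within G first l"
  shows "k \<le> l"
proof -
  obtain \<sigma> where \<sigma>: "legal_strategy G \<sigma>" "staller_wins_within G first l (case_player \<delta> \<sigma>)"
    using win \<delta> unfolding staller_can_win_within_def by blast
  then obtain n v where n: "n \<le> card (pverts G)" "v \<in> pverts G"
    "closed_nbhd G v \<subseteq> played_by first Staller (moves_made first (case_player \<delta> \<sigma>) n)"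
    "card (played_by first Staller (moves_made first (case_player \<delta> \<sigma>) n)) \<le> l"
    unfolding staller_wins_within_def staller_won_def by blast
  then have "card (closed_nbhd G v) \<le> l"
    by (meson card_mono finite_played_by le_trans)
  moreover have "k \<le> card (closed_nbhd G v)"
    using bound[OF \<sigma>(1) n(1,2) _ n(3)] by (meson not_le)
  ultimately show ?thesis
    by simp
qed

text \<open>Staller's opening covers at most one vertex of \<open>K\<close>, so Dominator's reply
  takes another one and blocks every closed neighbourhood containing \<open>K\<close>. By
  \<open>two\<close> she cannot win before that reply.\<close>

lemma gamma_SMB'_lower:
  assumes fin: "finite (pverts G)"
    and K: "K \<subseteq> pverts G" "2 \<le> card K"
    and two: "\<And>v. v \<in> pverts G \<Longrightarrow> 2 \<le> card (closed_nbhd G v)"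
    and small: "\<And>v. v \<in> pverts G \<Longrightarrow> card (closed_nbhd G v) < k \<Longrightarrow> K \<subseteq> closed_nbhd G v"
    and win: "staller_can_win_within G Staller l"
  shows "k \<le> l"
proof (rule staller_bound[OF _ _ win])
  let ?\<delta> = "priority_strategy (pverts G) {} K"
  show legal: "legal_strategy G ?\<delta>"
    using K by (intro legal_priority_strategy) auto
  fix n \<sigma> v
  assume \<sigma>: "legal_strategy G \<sigma>" and n: "n \<le> card (pverts G)" and v: "v \<in> pverts G"
    and less: "card (closed_nbhd G v) < k"
  let ?f = "case_player ?\<delta> \<sigma>"
  let ?h = "moves_made Staller ?f n"
  assume sub: "closed_nbhd G v \<subseteq> played_by Staller Staller ?h"
  have "2 \<le> card (played_by Staller Staller ?h)"
    using two[OF v] card_mono[OF finite_played_by sub] by simp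
  \<comment> \<open>One move gives Staller only one vertex, so Dominator's reply at index 1 is part
    of the play.\<close>
  then have "2 \<le> n"
    by (cases n; cases "n - 1") (auto simp: played_by_snoc split: if_splits)
  have "legal_strategy G (?f p)" for p
    using legal \<sigma> by (cases p) auto
  then have "distinct ?h"
    using set_moves_made_bounded[OF fin _ n] by blast
  have "\<not> K \<subseteq> set (moves_made Staller ?f 1)"
    using K(2) card_mono[of "{?f Staller []}" K] by (auto simp: to_move_def)
  then have "?\<delta> (moves_made Staller ?f 1) \<in> K"
    by (metis Diff_eq_empty_iff Diff_iff empty_subsetI priority_strategy_second)
  moreover have "?h ! 1 = ?\<delta> (moves_made Staller ?f 1)"
    using \<open>2 \<le> n\<close> by (subst nth_moves_made) (auto simp: to_move_def)
  moreover have "?h ! 1 \<in> played_by Staller Dominator ?h"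
    using \<open>2 \<le> n\<close> by (intro in_played_byI) (auto simp: to_move_def)
  ultimately show False
    using played_by_disjoint[OF \<open>distinct ?h\<close>] sub small[OF v less] by fastforce
qed

text \<open>Dominator opens with \<open>x\<close> and takes a vertex of \<open>K\<close> with his
  second move. Every closed neighbourhood with fewer than \<open>k\<close> vertices contains
  \<open>x\<close> or all of \<open>K\<close>, so it is blocked.\<close>

lemma gamma_SMB_lower:
  assumes fin: "finite (pverts G)"
    and x: "x \<in> pverts G" "x \<notin> K" and K: "K \<subseteq> pverts G" "2 \<le> card K"
    and two: "\<And>v. v \<in> pverts G \<Longrightarrow> 2 \<le> card (closed_nbhd G v)"
    and small: "\<And>v. v \<in> pverts G \<Longrightarrow> card (closed_nbhd G v) < k \<Longrightarrow>
      x \<in> closed_nbhd G v \<or> K \<subseteq> closed_nbhd G v"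
    and win: "staller_can_win_within G Dominator l"
  shows "k \<le> l"
proof (rule staller_bound[OF _ _ win])
  let ?\<delta> = "priority_strategy (pverts G) {x} K"
  show legal: "legal_strategy G ?\<delta>"
    using K x by (intro legal_priority_strategy) auto
  fix n \<sigma> v
  assume \<sigma>: "legal_strategy G \<sigma>" and n: "n \<le> card (pverts G)" and v: "v \<in> pverts G"
    and less: "card (closed_nbhd G v) < k"
  let ?f = "case_player ?\<delta> \<sigma>"
  let ?h = "moves_made Dominator ?f n"
  assume sub: "closed_nbhd G v \<subseteq> played_by Dominator Staller ?h"
  have "2 \<le> card (played_by Dominator Staller ?h)"
    using two[OF v] card_mono[OF finite_played_by sub] by simp
  \<comment> \<open>Staller moves at odd indices, so the first two moves include one of hers.
    Needing two, she wins only after Dominator's second move, at index 2.\<close>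
  moreover have "card (played_by Dominator Staller ?h) \<le> 1" if "n \<le> 2"
  proof -
    have "i = 1" if "i < n" "odd i" for i
      using that \<open>n \<le> 2\<close> by presburger
    then have "played_by Dominator Staller ?h \<subseteq> {?h ! 1}"
      by (auto simp: played_by_def to_move_def split: if_splits)
    then show ?thesis
      using card_mono[of "{?h ! 1}"] by simp
  qed
  ultimately have "3 \<le> n"
    by linarith
  have "legal_strategy G (?f p)" for p
    using legal \<sigma> by (cases p) auto
  then have "distinct ?h"
    using set_moves_made_bounded[OF fin _ n] by blast
  then have disj: "played_by Dominator Dominator ?h \<inter> played_by Dominator Staller ?h = {}"
    by (rule played_by_disjoint)
  have x0: "?\<delta> [] = x"
    using priority_strategy_first[of "{x}" "[]"] by auto
  define y where "y = \<sigma> [x]"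
  have M2: "moves_made Dominator ?f 2 = [x, y]"
    by (simp add: numeral_2_eq_2 to_move_def x0 y_def)
  \<comment> \<open>Since \<open>x\<close> is outside \<open>K\<close>, only \<open>y\<close> could
    have been taken from \<open>K\<close>, and \<open>K\<close> has two vertices.\<close>
  have "\<not> K \<subseteq> set [x, y]"
  proof
    assume "K \<subseteq> set [x, y]"
    then have "K \<subseteq> {y}"
      using x(2) by auto
    then show False
      using K(2) card_mono[of "{y}" K] by simp
  qed
  then have "K - set [x, y] \<noteq> {}"
    by blast
  then have inK: "?\<delta> [x, y] \<in> K"
    using priority_strategy_second[of "{x}" "[x, y]" K] by simp
  have "?h ! 0 = x"
    using \<open>3 \<le> n\<close> by (subst nth_moves_made) (simp_all add: to_move_def x0)
  moreover have "?h ! 0 \<in> played_by Dominator Dominator ?h"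
    using \<open>3 \<le> n\<close> by (intro in_played_byI) (simp_all add: to_move_def)
  ultimately have "x \<notin> closed_nbhd G v"
    using disj sub by auto
  then have "K \<subseteq> played_by Dominator Staller ?h"
    using small[OF v less] sub by blast
  with inK have "?\<delta> [x, y] \<in> played_by Dominator Staller ?h"
    by (rule subsetD[rotated])
  moreover have "?h ! 2 = ?\<delta> [x, y]"
    using \<open>3 \<le> n\<close> by (subst nth_moves_made) (simp_all add: to_move_def M2)
  moreover have "?h ! 2 \<in> played_by Dominator Dominator ?h"
    using \<open>3 \<le> n\<close> by (intro in_played_byI) (simp_all add: to_move_def)
  ultimately show False
    using disj by auto
qed

section \<open>The forest\<close>

text \<open>
  Component \<open>0\<close> is a path with \<open>l 0\<close> vertices; components \<open>1\<close> and \<open>2\<close> are perfect binary trees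
  with \<open>l 1\<close> and \<open>l 2\<close> levels.
\<close>
definition forest_nodes :: "(nat \<Rightarrow> nat) \<Rightarrow> (nat \<times> bool list) set" where
  "forest_nodes l = {(i, xs). i < 3 \<and> length xs < l i \<and> (i = 0 \<longrightarrow> set xs \<subseteq> {True})}"

text \<open>A word is the route from the root to a node, so \<open>prefix\<close> is the ancestor
  order. On component \<open>0\<close> this order is total, which makes that component a complete
  graph.\<close>

definition comparable :: "nat \<times> bool list \<Rightarrow> nat \<times> bool list \<Rightarrow> bool" where
  "comparable p q \<longleftrightarrow> fst p = fst q \<and> (prefix (snd p) (snd q) \<or> prefix (snd q) (snd p))"

text \<open>The injection \<open>to_nat\<close> makes the vertices natural numbers. As
  \<open>comparable\<close> is reflexive, \<open>p \<noteq> q\<close> excludes loops.\<close>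

definition forest_graph :: "(nat \<Rightarrow> nat) \<Rightarrow> nat pair_pre_digraph" where
  "forest_graph l =
     \<lparr>pverts = to_nat ` forest_nodes l,
      parcs = {(to_nat p, to_nat q) | p q.
        p \<in> forest_nodes l \<and> q \<in> forest_nodes l \<and> p \<noteq> q \<and> comparable p q}\<rparr>"

lemma finite_forest_nodes: "finite (forest_nodes l)"
proof (rule finite_subset)
  show "forest_nodes l \<subseteq> Sigma {..<3} (\<lambda>i. {xs. set xs \<subseteq> UNIV \<and> length xs \<le> l i})"
    by (auto simp: forest_nodes_def)
  show "finite (Sigma {..<3::nat} (\<lambda>i. {xs :: bool list. set xs \<subseteq> UNIV \<and> length xs \<le> l i}))"
    by (intro finite_SigmaI finite_lists_length_le) auto
qed

lemma pverts_forest_graph: "pverts (forest_graph l) = to_nat ` forest_nodes l"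
  by (simp add: forest_graph_def)

lemma finite_pverts_forest_graph: "finite (pverts (forest_graph l))"
  by (simp add: pverts_forest_graph finite_forest_nodes)

lemma comparable_sym: "comparable p q \<Longrightarrow> comparable q p"
  by (auto simp: comparable_def)

lemma pair_graph_forest_graph: "pair_graph (forest_graph l)"
proof
  have "parcs (forest_graph l) \<subseteq> pverts (forest_graph l) \<times> pverts (forest_graph l)"
    by (auto simp: forest_graph_def)
  then show "finite (parcs (forest_graph l))"
    using finite_pverts_forest_graph by (meson finite_SigmaI finite_subset)
  show "symmetric (with_proj (forest_graph l))"
    by (auto simp: symmetric_def arcs_ends_conv forest_graph_def intro!: symI dest: comparable_sym)
qed (auto simp: finite_pverts_forest_graph, auto simp: forest_graph_def)

section \<open>Closed neighbourhoods and root-to-leaf paths\<close>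

lemma closed_nbhd_forest_graph:
  assumes "p \<in> forest_nodes l"
  shows "closed_nbhd (forest_graph l) (to_nat p) = to_nat ` {q \<in> forest_nodes l. comparable p q}"
  using assms by (cases p) (auto simp: closed_nbhd_def nbhd_def forest_graph_def comparable_def)

text \<open>A leaf has no proper descendants, so the nodes comparable to it are its prefixes, one
  for each length below \<open>l i\<close>.\<close>

lemma closed_nbhd_leaf:
  assumes "(i, xs) \<in> forest_nodes l" and "Suc (length xs) = l i"
  shows "closed_nbhd (forest_graph l) (to_nat (i, xs)) = (\<lambda>j. to_nat (i, take j xs)) ` {..<l i}"
proof -
  have "{q \<in> forest_nodes l. comparable (i, xs) q} = (\<lambda>j. (i, take j xs)) ` {..<l i}"
  proof (intro equalityI subsetI)
    fix q assume q: "q \<in> {q \<in> forest_nodes l. comparable (i, xs) q}"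
    then obtain ys where ys: "q = (i, ys)" "length ys < l i" "prefix xs ys \<or> prefix ys xs"
      by (cases q) (auto simp: forest_nodes_def comparable_def)
    then have "prefix ys xs"
      using assms(2) by (metis less_Suc_eq_le prefix_length_prefix prefix_order.order_refl)
    then have "ys = take (length ys) xs"
      by (auto simp: prefix_def)
    then show "q \<in> (\<lambda>j. (i, take j xs)) ` {..<l i}"
      using ys by blast
  next
    fix q assume "q \<in> (\<lambda>j. (i, take j xs)) ` {..<l i}"
    then show "q \<in> {q \<in> forest_nodes l. comparable (i, xs) q}"
      using assms by (auto simp: forest_nodes_def comparable_def take_is_prefix dest: in_set_takeD)
  qed
  then show ?thesis
    using closed_nbhd_forest_graph[OF assms(1)] by (simp add: image_image)
qed

lemma card_closed_nbhd_leaf: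
  assumes "(i, xs) \<in> forest_nodes l" and "Suc (length xs) = l i"
  shows "card (closed_nbhd (forest_graph l) (to_nat (i, xs))) = l i"
proof -
  have "inj_on (\<lambda>j. to_nat (i, take j xs)) {..<l i}"
  proof (rule inj_onI)
    fix j k assume "j \<in> {..<l i}" "k \<in> {..<l i}" "to_nat (i, take j xs) = to_nat (i, take k xs)"
    then have "length (take j xs) = length (take k xs)" "j \<le> length xs" "k \<le> length xs"
      using assms(2) by auto
    then show "j = k"
      by simp
  qed
  then show ?thesis
    by (simp add: closed_nbhd_leaf[OF assms] card_image)
qed

text \<open>Descend from \<open>xs\<close> to a leaf \<open>zs\<close>: every prefix of
  \<open>zs\<close> is comparable to \<open>xs\<close>, both being prefixes of \<open>zs\<close>.
  Padding with \<open>True\<close> also stays inside component \<open>0\<close>.\<close>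

lemma closed_nbhd_contains_leaf_nbhd:
  assumes "(i, xs) \<in> forest_nodes l"
  obtains zs where "(i, zs) \<in> forest_nodes l" "Suc (length zs) = l i"
    "closed_nbhd (forest_graph l) (to_nat (i, zs)) \<subseteq> closed_nbhd (forest_graph l) (to_nat (i, xs))"
proof
  define zs where "zs = xs @ replicate (l i - Suc (length xs)) True"
  show zs: "(i, zs) \<in> forest_nodes l" "Suc (length zs) = l i"
    using assms by (auto simp: zs_def forest_nodes_def)
  have "to_nat (i, take j zs) \<in> closed_nbhd (forest_graph l) (to_nat (i, xs))" if "j < l i" for j
  proof -
    have "(i, take j zs) \<in> forest_nodes l"
      using zs that by (auto simp: forest_nodes_def dest: in_set_takeD)
    moreover have "prefix xs zs"
      by (simp add: zs_def)
    with take_is_prefix[of j zs] have "comparable (i, xs) (i, take j zs)"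
      using prefix_same_cases by (fastforce simp: comparable_def)
    ultimately show ?thesis
      by (simp add: closed_nbhd_forest_graph[OF assms])
  qed
  then show "closed_nbhd (forest_graph l) (to_nat (i, zs)) \<subseteq> closed_nbhd (forest_graph l) (to_nat (i, xs))"
    by (auto simp: closed_nbhd_leaf[OF zs])
qed

lemma finite_closed_nbhd_forest_graph:
  "p \<in> forest_nodes l \<Longrightarrow> finite (closed_nbhd (forest_graph l) (to_nat p))"
  by (simp add: closed_nbhd_forest_graph finite_forest_nodes)

lemma card_closed_nbhd_ge:
  assumes "(i, xs) \<in> forest_nodes l"
  shows "l i \<le> card (closed_nbhd (forest_graph l) (to_nat (i, xs)))"
proof (rule closed_nbhd_contains_leaf_nbhd[OF assms])
  fix zs
  assume zs: "(i, zs) \<in> forest_nodes l" "Suc (length zs) = l i"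
    "closed_nbhd (forest_graph l) (to_nat (i, zs)) \<subseteq> closed_nbhd (forest_graph l) (to_nat (i, xs))"
  show ?thesis
    using card_mono[OF finite_closed_nbhd_forest_graph[OF assms] zs(3)]
      card_closed_nbhd_leaf[OF zs(1,2)] by simp
qed

text \<open>Only components \<open>1\<close> and \<open>2\<close> branch. A tree with
  \<open>l i\<close> levels has height \<open>l i - 1\<close>.\<close>

lemma tree_embedding_forest_graph:
  assumes "i = 1 \<or> i = 2" and "0 < l i"
  shows "tree_embedding (forest_graph l) (\<lambda>xs. to_nat (i, xs)) (l i - 1)"
  unfolding tree_embedding_def
proof (intro conjI allI impI)
  show "inj_on (\<lambda>xs. to_nat (i, xs)) {xs :: bool list. length xs \<le> l i - 1}"
    by (auto intro: inj_onI)
  show "(\<lambda>xs. to_nat (i, xs)) ` {xs :: bool list. length xs \<le> l i - 1} \<subseteq> pverts (forest_graph l)"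
  proof (rule image_subsetI)
    fix xs :: "bool list" assume "xs \<in> {xs. length xs \<le> l i - 1}"
    then have "(i, xs) \<in> forest_nodes l"
      using assms by (auto simp: forest_nodes_def)
    then show "to_nat (i, xs) \<in> pverts (forest_graph l)"
      unfolding pverts_forest_graph by (rule imageI)
  qed
  fix xs :: "bool list" assume "length xs = l i - 1"
  then have "(i, xs) \<in> forest_nodes l" "Suc (length xs) = l i"
    using assms by (auto simp: forest_nodes_def)
  moreover have "{..<l i} \<subseteq> {..l i - 1}"
    by auto
  ultimately show "closed_nbhd (forest_graph l) (to_nat (i, xs))
      \<subseteq> (\<lambda>j. to_nat (i, take j xs)) ` {..l i - 1}"
    by (simp add: closed_nbhd_leaf image_mono)
qed

text \<open>A closed neighbourhood has one vertex more than the degree and at least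
  \<open>l i\<close> vertices in component \<open>i\<close>; the leaf of component \<open>0\<close>,
  whose \<open>l 0\<close> is smallest, attains the minimum.\<close>

lemma min_degree_forest_graph:
  assumes "0 < l 0" and "l 0 \<le> l 1" and "l 1 \<le> l 2"
  shows "min_degree (forest_graph l) + 1 = l 0"
proof -
  let ?G = "forest_graph l"
  let ?x = "to_nat (0 :: nat, replicate (l 0 - 1) True)"
  have card_nbhd: "card (nbhd ?G (to_nat p)) + 1 = card (closed_nbhd ?G (to_nat p))"
    if "p \<in> forest_nodes l" for p
  proof -
    have "to_nat p \<notin> nbhd ?G (to_nat p)"
      by (auto simp: nbhd_def forest_graph_def)
    then show ?thesis
      using finite_closed_nbhd_forest_graph[OF that] by (simp add: closed_nbhd_def)
  qed
  have leaf: "(0, replicate (l 0 - 1) True) \<in> forest_nodes l"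
    using assms by (auto simp: forest_nodes_def)
  have "card (closed_nbhd ?G ?x) = l 0"
    using assms by (intro card_closed_nbhd_leaf leaf) auto
  then have x: "card (nbhd ?G ?x) = l 0 - 1"
    using card_nbhd[OF leaf] by simp
  have "l 0 - 1 \<le> card (nbhd ?G v)" if v: "v \<in> pverts ?G" for v
  proof -
    obtain i xs where i: "v = to_nat (i, xs)" "(i, xs) \<in> forest_nodes l"
      using v by (auto simp: pverts_forest_graph)
    then have "i = 0 \<or> i = 1 \<or> i = 2"
      by (auto simp: forest_nodes_def)
    then have "l 0 \<le> l i"
      using assms by auto
    then show ?thesis
      using card_closed_nbhd_ge[OF i(2)] card_nbhd[OF i(2)] i(1) by simp
  qed
  moreover have "?x \<in> pverts ?G"
    using leaf by (simp add: pverts_forest_graph)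
  with x have "l 0 - 1 \<in> (\<lambda>v. card (nbhd ?G v)) ` pverts ?G"
    by (metis imageI)
  ultimately have "min_degree ?G = l 0 - 1"
    unfolding min_degree_def by (intro Min_eqI finite_imageI finite_pverts_forest_graph) blast+
  then show ?thesis
    using assms by simp
qed

section \<open>Values of both games on the forest\<close>

theorem theorem3p2:
  fixes r s t :: nat
  assumes "2 \<le> r" and "r \<le> s" and "s \<le> t"
  shows "\<exists>G :: nat pair_pre_digraph.
           pair_graph G \<and> pverts G \<noteq> {} \<and>
           min_degree G + 1 = r \<and> gamma_SMB' G = enat s \<and> gamma_SMB G = enat t"
proof -
  define l :: "nat \<Rightarrow> nat" where "l i = (if i = 0 then r else if i = 1 then s else t)" for i
  have l: "l 0 = r" "l 1 = s" "l 2 = t"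
    by (auto simp: l_def)
  let ?G = "forest_graph l"
  let ?T = "\<lambda>i xs. to_nat (i :: nat, xs :: bool list)"
  \<comment> \<open>Dominator's targets: \<open>?K\<close> is the whole component \<open>0\<close>,
    and \<open>?x\<close> is the root of the tree with \<open>s\<close> levels.\<close>
  let ?K = "?T 0 ` {xs. length xs < r \<and> set xs \<subseteq> {True}}"
  let ?x = "?T 1 []"
  note fin = finite_pverts_forest_graph[of l]
  have K: "?K \<subseteq> pverts ?G"
    by (auto simp: pverts_forest_graph forest_nodes_def l)
  have x: "?x \<in> pverts ?G" "?x \<notin> ?K"
    using assms by (auto simp: pverts_forest_graph forest_nodes_def l_def)
  have "{?T 0 [], ?T 0 [True]} \<subseteq> ?K"
    using assms by auto
  then have "card {?T 0 [], ?T 0 [True]} \<le> card ?K"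
    using finite_subset[OF K fin] by (rule card_mono[rotated])
  then have K2: "2 \<le> card ?K"
    by simp
  have nbhd: "l i \<le> card (closed_nbhd ?G v) \<and> (i = 0 \<longrightarrow> ?K \<subseteq> closed_nbhd ?G v) \<and>
      (i = 1 \<longrightarrow> ?x \<in> closed_nbhd ?G v)" if "v = ?T i xs" "(i, xs) \<in> forest_nodes l" for v i xs
  proof (intro conjI impI)
    show "l i \<le> card (closed_nbhd ?G v)"
      using card_closed_nbhd_ge that by simp
    show "?x \<in> closed_nbhd ?G v" if "i = 1"
      using \<open>v = _\<close> \<open>(i, xs) \<in> _\<close> that
      by (auto simp: closed_nbhd_forest_graph comparable_def forest_nodes_def)
    assume "i = 0"
    \<comment> \<open>Words over the single letter \<open>True\<close> are determined by their
      lengths, so any two of them are comparable.\<close>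
    have const: "zs = replicate (length zs) True" if "set zs \<subseteq> {True}" for zs
      using that by (metis replicate_length_same singletonD subsetD)
    have "comparable (0, xs) (0, ys)" if "set xs \<subseteq> {True}" "set ys \<subseteq> {True}" for ys
      unfolding comparable_def fst_conv snd_conv using const[OF that(1)] const[OF that(2)]
      by (metis le_cases le_add_diff_inverse prefixI replicate_add)
    then show "?K \<subseteq> closed_nbhd ?G v"
      using \<open>v = _\<close> \<open>(i, xs) \<in> _\<close> \<open>i = 0\<close>
      by (auto simp: closed_nbhd_forest_graph forest_nodes_def l intro!: imageI)
  qed
  \<comment> \<open>One disjunct per component. A cardinality below \<open>s\<close> leaves only the
    first, one below \<open>t\<close> only the first two.\<close>
  have nbhd_cases: "r \<le> card (closed_nbhd ?G v) \<and> ?K \<subseteq> closed_nbhd ?G v \<or>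
      s \<le> card (closed_nbhd ?G v) \<and> ?x \<in> closed_nbhd ?G v \<or> t \<le> card (closed_nbhd ?G v)"
    if "v \<in> pverts ?G" for v
  proof -
    obtain i xs where i: "v = ?T i xs" "(i, xs) \<in> forest_nodes l"
      using \<open>v \<in> pverts ?G\<close> by (auto simp: pverts_forest_graph)
    then consider "i = 0" | "i = 1" | "i = 2"
      by (force simp: forest_nodes_def)
    then show ?thesis
      by cases (use nbhd[OF i] l in simp_all)
  qed
  have two: "2 \<le> card (closed_nbhd ?G v)" if "v \<in> pverts ?G" for v
    using nbhd_cases[OF that] assms by linarith
  have small_s: "?K \<subseteq> closed_nbhd ?G v" if "v \<in> pverts ?G" "card (closed_nbhd ?G v) < s" for v
    using nbhd_cases[OF that(1)] that(2) assms by linarith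
  have small_t: "?x \<in> closed_nbhd ?G v \<or> ?K \<subseteq> closed_nbhd ?G v"
    if "v \<in> pverts ?G" "card (closed_nbhd ?G v) < t" for v
    using nbhd_cases[OF that(1)] that(2) by linarith
  have embed: "tree_embedding ?G (?T i) (l i - 1)" if "i = 1 \<or> i = 2" for i
    using assms that by (intro tree_embedding_forest_graph) (auto simp: l_def)
  have "tree_embedding ?G (?T 1) (s - 1)"
    using embed[of 1] unfolding l by simp
  \<comment> \<open>In the S-game nothing precedes Staller's first move, so the opening is
    \<open>[]\<close> and the smaller tree is available.\<close>
  then have "\<exists>a d. d < s \<and> tree_embedding ?G a d \<and> a ` {xs. length xs \<le> d} \<inter> set [] = {}"
    using assms by (intro exI[of _ "?T 1"] exI[of _ "s - 1"]) simp
  then have "staller_can_win_within ?G Staller s"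
    using fin x(1) by (intro staller_can_win_within_trees) auto
  then have "gamma_SMB' ?G = enat s"
    using gamma_SMB'_lower[OF fin K K2 two small_s] by (intro SMB_number_eqI)
  moreover have "staller_can_win_within ?G Dominator t"
  proof (rule staller_can_win_within_trees[OF fin])
    fix h :: "nat list"
    assume "length h = (if Dominator = Staller then 0 else 1)"
    then obtain y where h: "h = [y]"
      by (auto simp: length_Suc_conv)
    \<comment> \<open>Dominator's opening \<open>y\<close> touches at most one of the two trees.
      Staller uses the larger one only if \<open>y\<close> lies in the smaller; either has at most
      \<open>t\<close> levels.\<close>
    define i :: nat where "i = (if \<exists>xs. y = ?T 1 xs then 2 else 1)"
    have "l i - 1 < t"
      using assms by (auto simp: i_def l_def)
    moreover have "?T i ` {xs. length xs \<le> l i - 1} \<inter> set h = {}"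
      by (auto simp: i_def h)
    moreover have "tree_embedding ?G (?T i) (l i - 1)"
      by (rule embed) (simp add: i_def)
    ultimately show "\<exists>a d. d < t \<and> tree_embedding ?G a d \<and> a ` {xs. length xs \<le> d} \<inter> set h = {}"
      by blast
  qed (use x in auto)
  then have "gamma_SMB ?G = enat t"
    using gamma_SMB_lower[OF fin x K K2 two small_t] by (intro SMB_number_eqI)
  moreover have "min_degree ?G + 1 = r"
    using min_degree_forest_graph[of l] assms unfolding l by simp
  ultimately show ?thesis
    using pair_graph_forest_graph x(1) by blast
qed

end
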